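(* Let $m>1$ be real. For any $m$-spiral with first square of side length $L>0$ and center $(X_0,Y_0)$, the circumscribed circle of each of its squares passes through the pole of the spiral; that is, for every integer $i\ge 0$, the center $(X_i,Y_i)$ of the $i$-th square and the pole $(X_{eye},Y_{eye})$ satisfy $$(X_{eye}-X_i)^2+(Y_{eye}-Y_i)^2=\frac{L^2}{2m^{2i}}.$$
   Context: Let $m>1$ be real, $L>0$ and $(X_0,Y_0)\in\mathbb{R}^2$. The $m$-spiral (generalized whirling square spiral) with first square of side $L$ centered at $(X_0,Y_0)$ is given by a sequence of axis-parallel squares, the $i$-th square ($i\ge 0$) having side length $L_i=L/m^i$ and center $(X_i,Y_i)$, where the centers are placed clockwise by the recursion $$\begin{aligned} i\equiv 0 \pmod 4:&\quad X_{i+1}=X_i+\tfrac{L_i}{2}+\tfrac{L_i}{2m},\quad Y_{i+1}=Y_i+\tfrac{L_i}{2}-\tfrac{L_i}{2m};\\ i\equiv 1 \pmod 4:&\quad X_{i+1}=X_i+\tfrac{L_i}{2}-\tfrac{L_i}{2m},\quad Y_{i+1}=Y_i-\tfrac{L_i}{2}-\tfrac{L_i}{2m};\\ i\equiv 2 \pmod 4:&\quad X_{i+1}=X_i-\tfrac{L_i}{2}-\tfrac{L_i}{2m},\quad Y_{i+1}=Y_i-\tfrac{L_i}{2}+\tfrac{L_i}{2m};\\ i\equiv 3 \pmod 4:&\quad X_{i+1}=X_i-\tfrac{L_i}{2}+\tfrac{L_i}{2m},\quad Y_{i+1}=Y_i+\tfrac{L_i}{2}+\tfrac{L_i}{2m}.\end{aligned}$$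 The pole $(X_{eye},Y_{eye})$ of the $m$-spiral is the limit of the square centers $(X_i,Y_i)$ as $i\to\infty$. *)

theory Defs
  imports "HOL-Analysis.Analysis"
begin

definition spiral_side :: "real \<Rightarrow> real \<Rightarrow> nat \<Rightarrow> real" where
  "spiral_side m L i = L / m ^ i"

primrec spiral_center :: "real \<Rightarrow> real \<Rightarrow> real \<Rightarrow> real \<Rightarrow> nat \<Rightarrow> real \<times> real" where
  "spiral_center m L X0 Y0 0 = (X0, Y0)"
| "spiral_center m L X0 Y0 (Suc i) =
     (let X = fst (spiral_center m L X0 Y0 i);
          Y = snd (spiral_center m L X0 Y0 i);
          l = spiral_side m L i
      in if i mod 4 = 0 then (X + l / 2 + l / (2 * m), Y + l / 2 - l / (2 * m))
         else if i mod 4 = 1 then (X + l / 2 - l / (2 * m), Y - l / 2 - l / (2 * m))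
         else if i mod 4 = 2 then (X - l / 2 - l / (2 * m), Y - l / 2 + l / (2 * m))
         else (X - l / 2 + l / (2 * m), Y + l / 2 + l / (2 * m)))"

text \<open>\<^const>\<open>lim\<close> is meaningful only for convergent sequences, so results about the pole
  should also assert that the centers converge to it.\<close>

definition spiral_pole :: "real \<Rightarrow> real \<Rightarrow> real \<Rightarrow> real \<Rightarrow> real \<times> real" where
  "spiral_pole m L X0 Y0 = lim (spiral_center m L X0 Y0)"

definition square_corners :: "real \<times> real \<Rightarrow> real \<Rightarrow> (real \<times> real) set" where
  "square_corners c s =
     {fst c - s / 2, fst c + s / 2} \<times> {snd c - s / 2, snd c + s / 2}"

text \<open>The metric on \<^typ>\<open>real \<times> real\<close> is the Euclidean one, so \<^const>\<open>sphere\<close> is a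
  circle in the usual sense.\<close>

definition circumscribed_circle :: "(real \<times> real) set \<Rightarrow> (real \<times> real) set \<Rightarrow> bool" where
  "circumscribed_circle V C \<longleftrightarrow> (\<exists>c r. 0 < r \<and> C = sphere c r \<and> V \<subseteq> C)"

end

theory Submission
  imports Defs
begin

text \<open>
  Identify the plane with the complex numbers, and write \<open>z\<^sub>i\<close> for the \<open>i\<close>-th center,
  \<open>L\<^sub>i = L / m ^ i\<close> for its side and \<open>w\<^sub>i = (- \<i>) ^ i * (1 + \<i>)\<close> for a vector that makes a clockwise
  quarter turn at each step.  The four cases of the recursion are then the single rule
  \<open>z\<^sub>i\<^sub>+\<^sub>1 - z\<^sub>i = (L\<^sub>i * w\<^sub>i + L\<^sub>i\<^sub>+\<^sub>1 * w\<^sub>i\<^sub>+\<^sub>1) / 2\<close>.  The vectors \<open>L\<^sub>i * w\<^sub>i\<close> form a geometric sequence of ratio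
  \<open>q = - \<i> / m\<close>, so summing the steps from \<open>i\<close> on shows that the pole lies at
  \<open>z\<^sub>i + L\<^sub>i * w\<^sub>i * (1 + q) / (2 * (1 - q))\<close>.  As \<open>q\<close> is purely imaginary, \<open>1 + q\<close> and \<open>1 - q\<close> are
  conjugate, and the distance from \<open>z\<^sub>i\<close> to the pole is \<open>L\<^sub>i * \<bar>w\<^sub>i\<bar> / 2 = L\<^sub>i / sqrt 2\<close>, the
  circumradius of the square.

  The formal proof works in coordinates.  The limit of the series is replaced by an invariant:
  the point \<open>z\<^sub>i + L\<^sub>i * v\<^sub>i\<close>, with \<open>v\<^sub>i\<close> the offset \<open>w\<^sub>i * (1 + q) / (2 * (1 - q))\<close> written out, does not
  depend on \<open>i\<close> (\<open>spiral_center_plus_offset\<close>).  Since \<open>v\<^sub>i\<close> has constant length and \<open>L\<^sub>i\<close> tends to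
  \<open>0\<close>, the centers converge to that point (\<open>spiral_center_tendsto\<close>).  Finally, the circumscribed
  circle of a square is determined by its corners (\<open>circumscribed_circle_square\<close>).
\<close>

text \<open>The vector from the \<open>k\<close>-th center to the pole, in units of the \<open>k\<close>-th side.  For \<open>k = 0\<close> it is
  \<open>(1 + \<i>) * (m - \<i>) / (2 * (m + \<i>)) = (1 + \<i>) * (m - \<i>)\<^sup>2 / (2 * (m\<^sup>2 + 1))\<close>, whose numerator expands to
  \<open>(m\<^sup>2 - 1 + 2 * m) + \<i> * (m\<^sup>2 - 1 - 2 * m)\<close>; each further step is a clockwise quarter turn.\<close>

definition pole_offset :: "real \<Rightarrow> nat \<Rightarrow> real \<times> real" where
  "pole_offset m i =
     (let a = (m\<^sup>2 - 1 + 2 * m) / (2 * (m\<^sup>2 + 1));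
          b = (m\<^sup>2 - 1 - 2 * m) / (2 * (m\<^sup>2 + 1))
      in if i mod 4 = 0 then (a, b)
         else if i mod 4 = 1 then (b, - a)
         else if i mod 4 = 2 then (- a, - b)
         else (- b, a))"

lemma mod_4_cases:
  fixes i :: nat
  obtains "i mod 4 = 0" "Suc i mod 4 = 1" | "i mod 4 = 1" "Suc i mod 4 = 2"
    | "i mod 4 = 2" "Suc i mod 4 = 3" | "i mod 4 = 3" "Suc i mod 4 = 0"
proof -
  have "i mod 4 < 4" by simp
  then consider "i mod 4 = 0" | "i mod 4 = 1" | "i mod 4 = 2" | "i mod 4 = 3" by linarith
  then show thesis using that by cases (auto simp: mod_Suc)
qed

lemma norm_pole_offset_squared:
  "(fst (pole_offset m i))\<^sup>2 + (snd (pole_offset m i))\<^sup>2 = 1 / 2"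
proof -
  have pos: "m\<^sup>2 + 1 > 0" by (simp add: add_nonneg_pos)
  have "((m\<^sup>2 - 1 + 2 * m) / (2 * (m\<^sup>2 + 1)))\<^sup>2 + ((m\<^sup>2 - 1 - 2 * m) / (2 * (m\<^sup>2 + 1)))\<^sup>2
      = ((m\<^sup>2 - 1 + 2 * m)\<^sup>2 + (m\<^sup>2 - 1 - 2 * m)\<^sup>2) / (2 * (m\<^sup>2 + 1))\<^sup>2"
    by (simp only: power_divide flip: add_divide_distrib)
  also have "(m\<^sup>2 - 1 + 2 * m)\<^sup>2 + (m\<^sup>2 - 1 - 2 * m)\<^sup>2 = (2 * (m\<^sup>2 + 1))\<^sup>2 / 2"
    by (simp add: power2_eq_square algebra_simps)
  also have "(2 * (m\<^sup>2 + 1))\<^sup>2 / 2 / (2 * (m\<^sup>2 + 1))\<^sup>2 = 1 / 2"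
    using pos by simp
  finally show ?thesis
    by (cases i rule: mod_4_cases) (auto simp: pole_offset_def Let_def add.commute)
qed

lemma spiral_center_plus_offset:
  assumes "m > 0"
  shows "spiral_center m L X0 Y0 i + spiral_side m L i *\<^sub>R pole_offset m i
       = (X0, Y0) + L *\<^sub>R pole_offset m 0"
proof (induction i)
  case 0
  show ?case by (simp add: spiral_side_def)
next
  case (Suc i)
  define l where "l = spiral_side m L i"
  define a where "a = (m\<^sup>2 - 1 + 2 * m) / (2 * (m\<^sup>2 + 1))"
  define b where "b = (m\<^sup>2 - 1 - 2 * m) / (2 * (m\<^sup>2 + 1))"
  have offset: "pole_offset m j =
      (if j mod 4 = 0 then (a, b) else if j mod 4 = 1 then (b, - a)
       else if j mod 4 = 2 then (- a, - b) else (- b, a))" for j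
    by (simp only: pole_offset_def Let_def a_def b_def)
  have l_Suc: "spiral_side m L (Suc i) = l / m"
    by (simp add: l_def spiral_side_def field_simps)
  have pos: "m\<^sup>2 + 1 > 0" by (simp add: add_nonneg_pos)
  \<comment> \<open>The real and imaginary parts of \<open>v\<^sub>0 * (1 - q) = w\<^sub>0 * (1 + q) / 2\<close>, multiplied by \<open>m\<close>.\<close>
  have ab: "m * a = m / 2 + 1 / 2 + b" "m * b = m / 2 - 1 / 2 - a"
    unfolding a_def b_def using pos
    by (simp_all add: divide_simps) (simp_all add: power2_eq_square algebra_simps)
  have "l * a = l / m * (m * a)"
    using assms by simp
  also have "\<dots> = l / 2 + l / (2 * m) + l * b / m"
    unfolding ab using assms by (simp add: field_simps)
  finally have la: "l * a = l / 2 + l / (2 * m) + l * b / m" .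
  have "l * b = l / m * (m * b)"
    using assms by simp
  also have "\<dots> = l / 2 - l / (2 * m) - l * a / m"
    unfolding ab using assms by (simp add: field_simps)
  finally have lb: "l * b = l / 2 - l / (2 * m) - l * a / m" .
  have "spiral_center m L X0 Y0 (Suc i) + (l / m) *\<^sub>R pole_offset m (Suc i)
      = spiral_center m L X0 Y0 i + l *\<^sub>R pole_offset m i"
    by (cases i rule: mod_4_cases)
      (simp_all add: offset Let_def prod_eq_iff flip: l_def,
       (intro conjI; use la lb in linarith)+)
  with Suc show ?case by (simp only: l_Suc l_def)
qed

lemma spiral_center_tendsto:
  assumes "m > 1"
  shows "spiral_center m L X0 Y0 \<longlonglongrightarrow> (X0, Y0) + L *\<^sub>R pole_offset m 0"
proof -
  have "(\<lambda>i. L * (1 / m) ^ i) \<longlonglongrightarrow> L * 0"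
    using assms by (intro tendsto_mult_left LIMSEQ_realpow_zero) auto
  then have side: "spiral_side m L \<longlonglongrightarrow> 0"
    by (simp add: spiral_side_def [abs_def] power_inverse divide_inverse)
  have "norm (pole_offset m i) \<le> sqrt (1 / 2)" for i
    using norm_pole_offset_squared [of m i] by (simp add: norm_prod_def)
  then have "Bfun (pole_offset m) sequentially"
    by (intro BfunI always_eventually) auto
  with side have "(\<lambda>i. spiral_side m L i *\<^sub>R pole_offset m i) \<longlonglongrightarrow> 0"
    unfolding tendsto_Zfun_iff
    by (auto intro: bounded_bilinear.Zfun_prod_Bfun [OF bounded_bilinear_scaleR])
  then have "(\<lambda>i. (X0, Y0) + L *\<^sub>R pole_offset m 0 - spiral_side m L i *\<^sub>R pole_offset m i)
      \<longlonglongrightarrow> (X0, Y0) + L *\<^sub>R pole_offset m 0 - 0"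
    by (intro tendsto_diff tendsto_const)
  moreover have "(\<lambda>i. (X0, Y0) + L *\<^sub>R pole_offset m 0 - spiral_side m L i *\<^sub>R pole_offset m i)
      = spiral_center m L X0 Y0"
    using spiral_center_plus_offset [of m L X0 Y0] assms by (auto simp: fun_eq_iff algebra_simps)
  ultimately show ?thesis by simp
qed

lemma spiral_pole_eq:
  assumes "m > 1"
  shows "spiral_pole m L X0 Y0 = spiral_center m L X0 Y0 i + spiral_side m L i *\<^sub>R pole_offset m i"
  using limI [OF spiral_center_tendsto [OF assms]] spiral_center_plus_offset [of m] assms
  by (simp add: spiral_pole_def)

lemma dist_prod_real_squared:
  fixes p q :: "real \<times> real"
  shows "(dist p q)\<^sup>2 = (fst q - fst p)\<^sup>2 + (snd q - snd p)\<^sup>2"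
  by (simp add: dist_prod_def dist_real_def power2_commute)

lemma circumscribed_circle_square:
  assumes "s > 0" and "circumscribed_circle (square_corners c s) C"
  shows "C = {p. (fst p - fst c)\<^sup>2 + (snd p - snd c)\<^sup>2 = s\<^sup>2 / 2}"
proof -
  obtain d r where r: "r > 0" and C: "C = sphere d r" and sub: "square_corners c s \<subseteq> C"
    using assms(2) unfolding circumscribed_circle_def by blast
  have mem: "p \<in> C \<longleftrightarrow> (fst p - fst d)\<^sup>2 + (snd p - snd d)\<^sup>2 = r\<^sup>2" for p
    unfolding C using r dist_prod_real_squared [of d p]
    by (simp add: power2_eq_iff_nonneg flip: dist_prod_real_squared)
  have corner: "(x - fst d)\<^sup>2 + (y - snd d)\<^sup>2 = r\<^sup>2"
    if "x \<in> {fst c - s / 2, fst c + s / 2}" "y \<in> {snd c - s / 2, snd c + s / 2}" for x y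
    using sub that mem [of "(x, y)"] by (auto simp: square_corners_def)
  \<comment> \<open>Adjacent corners are equidistant from \<open>d\<close>, which forces each coordinate of \<open>d\<close>.\<close>
  have "(fst c - s / 2 - fst d)\<^sup>2 = (fst c + s / 2 - fst d)\<^sup>2"
    using corner [of "fst c - s / 2" "snd c - s / 2"] corner [of "fst c + s / 2" "snd c - s / 2"]
    by simp
  then have "fst d = fst c"
    using assms(1) by (simp add: power2_eq_square algebra_simps)
  moreover have "(snd c - s / 2 - snd d)\<^sup>2 = (snd c + s / 2 - snd d)\<^sup>2"
    using corner [of "fst c - s / 2" "snd c - s / 2"] corner [of "fst c - s / 2" "snd c + s / 2"]
    by simp
  then have "snd d = snd c"
    using assms(1) by (simp add: power2_eq_square algebra_simps)
  ultimately have d: "fst d = fst c" "snd d = snd c" by auto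
  have "r\<^sup>2 = s\<^sup>2 / 2"
    using corner [of "fst c + s / 2" "snd c + s / 2"]
    by (simp add: d power2_eq_square)
  with mem d show ?thesis by auto
qed

theorem theorem2p6:
  fixes m L X0 Y0 :: real
  assumes "m > 1" and "L > 0"
  shows "spiral_center m L X0 Y0 \<longlonglongrightarrow> spiral_pole m L X0 Y0 \<and>
    (\<forall>i::nat.
       (\<forall>C. circumscribed_circle
               (square_corners (spiral_center m L X0 Y0 i) (spiral_side m L i)) C
             \<longrightarrow> spiral_pole m L X0 Y0 \<in> C) \<and>
       (fst (spiral_pole m L X0 Y0) - fst (spiral_center m L X0 Y0 i))\<^sup>2
         + (snd (spiral_pole m L X0 Y0) - snd (spiral_center m L X0 Y0 i))\<^sup>2
         = L\<^sup>2 / (2 * m ^ (2 * i)))"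
proof (intro conjI allI impI)
  show "spiral_center m L X0 Y0 \<longlonglongrightarrow> spiral_pole m L X0 Y0"
    using spiral_center_tendsto [OF assms(1), of L X0 Y0] limI by (metis spiral_pole_def)
next
  fix i
  let ?z = "spiral_center m L X0 Y0 i" and ?p = "spiral_pole m L X0 Y0"
  have "(fst ?p - fst ?z)\<^sup>2 + (snd ?p - snd ?z)\<^sup>2
      = (spiral_side m L i)\<^sup>2 * ((fst (pole_offset m i))\<^sup>2 + (snd (pole_offset m i))\<^sup>2)"
    by (simp add: spiral_pole_eq [OF assms(1), of L X0 Y0 i] power_mult_distrib distrib_left)
  then have dist: "(fst ?p - fst ?z)\<^sup>2 + (snd ?p - snd ?z)\<^sup>2 = (spiral_side m L i)\<^sup>2 / 2"
    by (simp add: norm_pole_offset_squared)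
  then show "(fst ?p - fst ?z)\<^sup>2 + (snd ?p - snd ?z)\<^sup>2 = L\<^sup>2 / (2 * m ^ (2 * i))"
    by (simp add: spiral_side_def power_divide power_even_eq)
  fix C
  assume "circumscribed_circle (square_corners ?z (spiral_side m L i)) C"
  moreover have "spiral_side m L i > 0"
    using assms by (simp add: spiral_side_def)
  ultimately show "?p \<in> C"
    using dist circumscribed_circle_square by blast
qed

end
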